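(* For all integers $n,m\ge1$ and every partition $O$ of $n$, the language $CFG(O,n,m)$ is a greedoid.
   Context: A partition of $n$ is a sequence $x=(x_1,\ldots,x_n)$ of nonnegative integers with $x_1\ge\cdots\ge x_n$ and $\sum x_i=n$ (with $x_j=0$ for $j>n$). The $CFG(n,m)$ transition at position $i$ is allowed on a partition $x$ of $n$ when $x_i-x_{i+1}\ge m+1$, and replaces $x_i$ by $x_i-m$ and $x_j$ by $x_j+1$ for each $j\in\{i+1,\ldots,i+m\}$, leaving the other entries unchanged (the result is again a partition of $n$). The language $CFG(O,n,m)$ over the alphabet $A=\{1,\ldots,n\}$ is the set of words $\alpha=(i_1,\ldots,i_r)\in A^*$ for which there is a play sequence $O=c_0\to c_1\to\cdots\to c_r$ such that $c_{s-1}\to c_s$ is an allowed transition at position $i_s$ for each $s$. A language $L$ is a greedoid if it is left-hereditary, i.e. $\alpha\gamma\in L\Rightarrow\alpha\in L$, and satisfies the exchange condition: for all $\alpha,\beta\in L$ with $|\beta|>|\alpha|$ there exists a letter $x$ in $\beta$ such that $\alpha x\in L$. *)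

theory Defs
  imports Main
begin

text \<open>
  A partition \<open>(x\<^sub>1, \<dots>, x\<^sub>n)\<close> of \<open>n\<close> is encoded as a function on \<open>nat\<close> with 1-based positions
  that vanishes outside \<open>{1..n}\<close>; position \<open>0\<close> is not used and is set to \<open>0\<close> as well, which makes
  the encoding unique.
\<close>

definition partition_of :: "nat \<Rightarrow> (nat \<Rightarrow> nat) \<Rightarrow> bool" where
  "partition_of n x \<longleftrightarrow>
     (\<forall>i. 1 \<le> i \<and> i < n \<longrightarrow> x i \<ge> x (i + 1)) \<and>
     (\<Sum>i = 1..n. x i) = n \<and>
     (\<forall>j. j \<notin> {1..n} \<longrightarrow> x j = 0)"

definition cfg_fire :: "nat \<Rightarrow> nat \<Rightarrow> (nat \<Rightarrow> nat) \<Rightarrow> (nat \<Rightarrow> nat)" where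
  "cfg_fire m i x =
     (\<lambda>j. if j = i then x i - m else if j \<in> {i + 1..i + m} then x j + 1 else x j)"

text \<open>The difference \<open>x\<^sub>i - x\<^sub>i\<^sub>+\<^sub>1\<close> is taken in the integers, so there is no truncation.\<close>

definition cfg_step :: "nat \<Rightarrow> nat \<Rightarrow> nat \<Rightarrow> (nat \<Rightarrow> nat) \<Rightarrow> (nat \<Rightarrow> nat) \<Rightarrow> bool" where
  "cfg_step n m i x y \<longleftrightarrow>
     partition_of n x \<and> int (x i) - int (x (i + 1)) \<ge> int m + 1 \<and> y = cfg_fire m i x"

text \<open>Words are lists, indexed from \<open>0\<close>: the letter \<open>\<alpha> ! s\<close> labels the step from \<open>c s\<close> to \<open>c (s + 1)\<close>.\<close>

definition CFG :: "(nat \<Rightarrow> nat) \<Rightarrow> nat \<Rightarrow> nat \<Rightarrow> nat list set" where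
  "CFG x0 n m =
     {\<alpha> \<in> lists {1..n}. \<exists>c :: nat \<Rightarrow> nat \<Rightarrow> nat.
        c 0 = x0 \<and> (\<forall>s < length \<alpha>. cfg_step n m (\<alpha> ! s) (c s) (c (s + 1)))}"

definition left_hereditary :: "'a list set \<Rightarrow> bool" where
  "left_hereditary L \<longleftrightarrow> (\<forall>\<alpha> \<gamma>. \<alpha> @ \<gamma> \<in> L \<longrightarrow> \<alpha> \<in> L)"

definition exchange_condition :: "'a list set \<Rightarrow> bool" where
  "exchange_condition L \<longleftrightarrow>
     (\<forall>\<alpha> \<in> L. \<forall>\<beta> \<in> L. length \<beta> > length \<alpha> \<longrightarrow> (\<exists>x \<in> set \<beta>. \<alpha> @ [x] \<in> L))"

definition greedoid :: "'a list set \<Rightarrow> bool" where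
  "greedoid L \<longleftrightarrow> left_hereditary L \<and> exchange_condition L"

end

theory Submission
  imports Defs
begin

text \<open>
  In terms of the differences \<open>d\<^sub>i = x\<^sub>i - x\<^sub>i\<^sub>+\<^sub>1\<close> the game is a chip firing game on a directed graph: position
  \<open>i\<close> may fire once \<open>d\<^sub>i \<ge> m + 1\<close>, and then sends \<open>m\<close> chips to \<open>i - 1\<close> and one chip to \<open>i + m\<close>. Hence
  the number of chips at \<open>i\<close> depends only on how often each position has fired, and firing other
  positions never decreases it. Given \<open>\<alpha>\<close> and a longer \<open>\<beta>\<close>, stop \<open>\<beta>\<close> just before some letter \<open>x\<close> first
  occurs more often than in \<open>\<alpha>\<close>: compared with this moment, after \<open>\<alpha>\<close> position \<open>x\<close> has fired equally
  often and every other position at least as often, so \<open>x\<close> can fire after \<open>\<alpha>\<close> as well.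
\<close>

lemma partition_of_mono:
  assumes "partition_of n x" and "1 \<le> i" and "i \<le> j"
  shows "x j \<le> x i"
  using assms(3)
proof (induction j rule: dec_induct)
  case (step j)
  have "x (Suc j) \<le> x j"
  proof (cases "j < n")
    case True
    then show ?thesis
      using assms(1,2) step.hyps unfolding partition_of_def by auto
  next
    case False
    then show ?thesis
      using assms(1) unfolding partition_of_def by auto
  qed
  with step.IH show ?case by simp
qed simp

text \<open>The first \<open>i\<close> entries are all at least \<open>m + 1\<close>, so
  \<open>n\<close> is at least \<open>i * (m + 1)\<close>, hence at least \<open>i + m\<close>. Thus
  firing never pushes a unit past position \<open>n\<close>.\<close>

lemma partition_of_fire_fits:
  assumes "partition_of n x" and "1 \<le> i" and "m + 1 \<le> x i"
  shows "i + m \<le> n"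
proof -
  have "i \<le> n"
    using assms unfolding partition_of_def by (cases "i \<le> n") auto
  have "i + m \<le> i * (m + 1)"
    using assms(2) by (cases i) auto
  also have "\<dots> = (\<Sum>j = 1..i. m + 1)"
    by simp
  also have "\<dots> \<le> (\<Sum>j = 1..i. x j)"
  proof (rule sum_mono)
    fix j
    assume "j \<in> {1..i}"
    then show "m + 1 \<le> x j"
      using partition_of_mono[OF assms(1), of j i] assms(3) by simp
  qed
  also have "\<dots> \<le> (\<Sum>j = 1..n. x j)"
    using \<open>i \<le> n\<close> by (intro sum_mono2) auto
  also have "\<dots> = n"
    using assms(1) unfolding partition_of_def by simp
  finally show ?thesis .
qed

lemma cfg_step_partition_of:
  assumes step: "cfg_step n m i x y" and "1 \<le> i"
  shows "partition_of n y"
proof -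
  have x: "partition_of n x" and y: "y = cfg_fire m i x" and d: "x (i + 1) + m + 1 \<le> x i"
    using step unfolding cfg_step_def by auto
  have fits: "i + m \<le> n"
    using partition_of_fire_fits[OF x \<open>1 \<le> i\<close>] d by simp
  \<comment> \<open>Only the gap between \<open>i\<close> and \<open>i + 1\<close> can shrink, by at
    most \<open>m + 1\<close>, which \<open>d\<close> permits.\<close>
  have mono: "y (j + 1) \<le> y j" if "1 \<le> j" for j
    using partition_of_mono[OF x that, of "j + 1"] d
    unfolding y cfg_fire_def by auto
  \<comment> \<open>Adding \<open>m\<close> to both sides, and crediting it to entry
    \<open>i\<close>, avoids the truncated subtraction in \<open>cfg_fire\<close> and allows a
    termwise comparison.\<close>
  have "(\<Sum>j = 1..n. y j) + m = (\<Sum>j = 1..n. x j) + m"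
  proof -
    have "(\<Sum>j = 1..n. y j) + m = (\<Sum>j = 1..n. y j + (if j = i then m else 0))"
      using fits \<open>1 \<le> i\<close> by (simp add: sum.distrib)
    also have "\<dots> = (\<Sum>j = 1..n. x j + (if j \<in> {i + 1..i + m} then 1 else 0))"
      using d unfolding y cfg_fire_def by (intro sum.cong) auto
    also have "\<dots> = (\<Sum>j = 1..n. x j) + card ({1..n} \<inter> {i + 1..i + m})"
      unfolding sum.distrib by (subst sum.inter_restrict[symmetric]) simp_all
    also have "{1..n} \<inter> {i + 1..i + m} = {i + 1..i + m}"
      using fits by auto
    finally show ?thesis by simp
  qed
  moreover have "y j = 0" if "j \<notin> {1..n}" for j
    using that x fits \<open>1 \<le> i\<close> unfolding partition_of_def y cfg_fire_def by auto
  ultimately show ?thesis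
    using x mono unfolding partition_of_def by auto
qed

text \<open>A step determines its target, so the play sequence is forced up to the length of the
  word; this removes the existential and makes induction on the last letter possible.\<close>

lemma CFG_iff_fold:
  "\<alpha> \<in> CFG x0 n m \<longleftrightarrow> \<alpha> \<in> lists {1..n} \<and>
     (\<forall>s < length \<alpha>. cfg_step n m (\<alpha> ! s) (fold (cfg_fire m) (take s \<alpha>) x0)
        (fold (cfg_fire m) (take (s + 1) \<alpha>) x0))"
  (is "_ \<longleftrightarrow> _ \<and> ?steps")
proof
  assume "\<alpha> \<in> CFG x0 n m"
  then obtain c where \<alpha>: "\<alpha> \<in> lists {1..n}" and c0: "c 0 = x0"
    and c: "\<And>s. s < length \<alpha> \<Longrightarrow> cfg_step n m (\<alpha> ! s) (c s) (c (s + 1))"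
    unfolding CFG_def by blast
  have fold: "c s = fold (cfg_fire m) (take s \<alpha>) x0" if "s \<le> length \<alpha>" for s
    using that
  proof (induction s)
    case (Suc s)
    then have "c (Suc s) = cfg_fire m (\<alpha> ! s) (c s)"
      using c[of s] unfolding cfg_step_def by simp
    with Suc show ?case
      by (simp add: take_Suc_conv_app_nth)
  qed (simp add: c0)
  have ?steps
    using c fold by simp
  with \<alpha> show "\<alpha> \<in> lists {1..n} \<and> ?steps" ..
next
  assume *: "\<alpha> \<in> lists {1..n} \<and> ?steps"
  show "\<alpha> \<in> CFG x0 n m"
    unfolding CFG_def using *
    by (auto intro!: exI[of _ "\<lambda>s. fold (cfg_fire m) (take s \<alpha>) x0"])
qed

lemma Nil_in_CFG: "[] \<in> CFG x0 n m"
  by (simp add: CFG_iff_fold)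

lemma CFG_snoc_iff:
  "\<alpha> @ [i] \<in> CFG x0 n m \<longleftrightarrow> \<alpha> \<in> CFG x0 n m \<and> i \<in> {1..n} \<and>
     cfg_step n m i (fold (cfg_fire m) \<alpha> x0) (cfg_fire m i (fold (cfg_fire m) \<alpha> x0))"
  by (auto simp: CFG_iff_fold nth_append less_Suc_eq)

lemma left_hereditary_CFG: "left_hereditary (CFG x0 n m)"
  unfolding left_hereditary_def
proof (intro allI impI)
  fix \<alpha> \<gamma>
  show "\<alpha> @ \<gamma> \<in> CFG x0 n m \<Longrightarrow> \<alpha> \<in> CFG x0 n m"
    by (induction \<gamma> rule: rev_induct) (simp_all add: CFG_snoc_iff flip: append_assoc)
qed

lemma partition_of_fold_cfg_fire:
  assumes "partition_of n x0" and "\<alpha> \<in> CFG x0 n m"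
  shows "partition_of n (fold (cfg_fire m) \<alpha> x0)"
  using assms(2)
proof (induction \<alpha> rule: rev_induct)
  case (snoc i \<alpha>)
  then show ?case
    by (auto simp: CFG_snoc_iff intro: cfg_step_partition_of)
qed (simp add: assms(1))

text \<open>For \<open>j \<le> m\<close> the truncated index \<open>j - m\<close> is \<open>0\<close>, a letter that never occurs in a word of the
  language.\<close>

lemma fold_cfg_fire_diff:
  assumes "\<alpha> \<in> CFG x0 n m" and "1 \<le> j"
  shows "int (fold (cfg_fire m) \<alpha> x0 j) - int (fold (cfg_fire m) \<alpha> x0 (j + 1)) =
    int (x0 j) - int (x0 (j + 1)) - (int m + 1) * int (count_list \<alpha> j)
      + int m * int (count_list \<alpha> (j + 1)) + int (count_list \<alpha> (j - m))"
  using assms(1)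
proof (induction \<alpha> rule: rev_induct)
  case (snoc i \<alpha>)
  define x where "x = fold (cfg_fire m) \<alpha> x0"
  have \<alpha>: "\<alpha> \<in> CFG x0 n m" and "1 \<le> i" and d: "x (i + 1) + m + 1 \<le> x i"
    using snoc.prems unfolding CFG_snoc_iff cfg_step_def x_def by auto
  \<comment> \<open>The last term is the right end of the block of raised entries:
    \<open>j = i + m\<close> is raised while \<open>j + 1\<close> is not.\<close>
  have "int (cfg_fire m i x j) - int (cfg_fire m i x (j + 1)) = int (x j) - int (x (j + 1))
      - (if i = j then int m + 1 else 0) + (if i = j + 1 then int m else 0)
      + (if i = j - m then 1 else 0)"
    using d \<open>1 \<le> i\<close> \<open>1 \<le> j\<close> unfolding cfg_fire_def by auto
  with snoc.IH[OF \<alpha>] show ?case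
    by (cases "i = j"; cases "i = j + 1"; cases "i = j - m")
      (simp_all add: algebra_simps flip: x_def)
qed simp

text \<open>Induction from the right finds the shortest prefix with an excess: if dropping the last
  letter removes every excess, that letter is \<open>x\<close>, and its count before was squeezed to
  equality.\<close>

lemma first_excess_letter:
  assumes "\<exists>y. count_list \<alpha> y < count_list \<beta> y"
  shows "\<exists>\<beta>1 x \<beta>2. \<beta> = \<beta>1 @ x # \<beta>2 \<and> (\<forall>z. count_list \<beta>1 z \<le> count_list \<alpha> z) \<and>
    count_list \<beta>1 x = count_list \<alpha> x"
  using assms
proof (induction \<beta> rule: rev_induct)
  case (snoc w \<beta>)
  show ?case
  proof (cases "\<exists>y. count_list \<alpha> y < count_list \<beta> y")
    case True
    then obtain \<beta>1 x \<beta>2 where "\<beta> = \<beta>1 @ x # \<beta>2"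
      and "\<forall>z. count_list \<beta>1 z \<le> count_list \<alpha> z" and "count_list \<beta>1 x = count_list \<alpha> x"
      using snoc.IH by blast
    then show ?thesis
      by (intro exI[of _ \<beta>1] exI[of _ x] exI[of _ "\<beta>2 @ [w]"]) simp
  next
    case False
    then have le: "count_list \<beta> z \<le> count_list \<alpha> z" for z
      by (metis not_le)
    obtain y where y: "count_list \<alpha> y < count_list (\<beta> @ [w]) y"
      using snoc.prems by blast
    with le[of y] have "y = w"
      by (auto split: if_splits)
    with y le[of w] have "count_list \<beta> w = count_list \<alpha> w"
      by simp
    with le show ?thesis
      by blast
  qed
qed simp

lemma exists_excess_letter:
  assumes "length \<alpha> < length \<beta>"
  shows "\<exists>y. count_list \<alpha> y < count_list \<beta> y"
proof (rule ccontr)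
  assume "\<not> ?thesis"
  \<comment> \<open>Over the union of both letter sets, each sum of counts is the length of its
    word.\<close>
  then have "(\<Sum>y \<in> set \<alpha> \<union> set \<beta>. count_list \<beta> y) \<le> (\<Sum>y \<in> set \<alpha> \<union> set \<beta>. count_list \<alpha> y)"
    by (intro sum_mono) (simp add: not_less)
  with assms show False
    by (simp add: sum_count_set)
qed

lemma exchange_condition_CFG:
  assumes "partition_of n x0"
  shows "exchange_condition (CFG x0 n m)"
  unfolding exchange_condition_def
proof (intro ballI impI)
  fix \<alpha> \<beta>
  assume \<alpha>: "\<alpha> \<in> CFG x0 n m" and \<beta>: "\<beta> \<in> CFG x0 n m" and "length \<alpha> < length \<beta>"
  obtain \<beta>1 x \<beta>2 where split: "\<beta> = \<beta>1 @ x # \<beta>2"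
    and le: "\<And>z. count_list \<beta>1 z \<le> count_list \<alpha> z" and eq: "count_list \<beta>1 x = count_list \<alpha> x"
    using first_excess_letter[OF exists_excess_letter[OF \<open>length \<alpha> < length \<beta>\<close>]] by blast
  have "\<beta>1 @ [x] \<in> CFG x0 n m"
    using \<beta> left_hereditary_CFG[of x0 n m] unfolding split left_hereditary_def
    by (metis append.assoc append_Cons append_Nil)
  then have \<beta>1: "\<beta>1 \<in> CFG x0 n m" and x: "x \<in> {1..n}"
    and d: "int m + 1 \<le> int (fold (cfg_fire m) \<beta>1 x0 x) - int (fold (cfg_fire m) \<beta>1 x0 (x + 1))"
    unfolding CFG_snoc_iff cfg_step_def by auto
  have "1 \<le> x"
    using x by simp
  \<comment> \<open>This product of two variables is the only nonlinear comparison; the other counts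
    enter linearly or agree by \<open>eq\<close>.\<close>
  have "int m * int (count_list \<beta>1 (x + 1)) \<le> int m * int (count_list \<alpha> (x + 1))"
    using le by (intro mult_left_mono) auto
  with d le[of "x - m"]
  have "int m + 1 \<le> int (fold (cfg_fire m) \<alpha> x0 x) - int (fold (cfg_fire m) \<alpha> x0 (x + 1))"
    unfolding fold_cfg_fire_diff[OF \<alpha> \<open>1 \<le> x\<close>] fold_cfg_fire_diff[OF \<beta>1 \<open>1 \<le> x\<close>] eq by linarith
  then have "\<alpha> @ [x] \<in> CFG x0 n m"
    using \<alpha> x partition_of_fold_cfg_fire[OF assms \<alpha>] unfolding CFG_snoc_iff cfg_step_def by simp
  then show "\<exists>x \<in> set \<beta>. \<alpha> @ [x] \<in> CFG x0 n m"
    unfolding split by auto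
qed

theorem theorem4:
  fixes n m :: nat and x0 :: "nat \<Rightarrow> nat"
  assumes "n \<ge> 1" and "m \<ge> 1"
    and "partition_of n x0"
  shows "greedoid (CFG x0 n m)"
  using left_hereditary_CFG exchange_condition_CFG[OF assms(3)] unfolding greedoid_def ..

end
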